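(* Let $n\geq 1$, $\lambda>0$, $\phi\in(1,2)$, and let $\alpha_i>0$, $\beta_i\in(0,1)$, $i\in\{1,\ldots,n\}$, satisfy $$1+\frac{\sum_{i=1}^{n}\alpha_i}{\sum_{i=1}^{n}\frac{1+\beta_i}{1-\beta_i}\alpha_i}=\phi .$$ Put $\alpha=(\alpha_1,\ldots,\alpha_n)^{\top}$, $\beta=(\beta_1,\ldots,\beta_n)^{\top}$, and consider the state-dependent switched system (the A-AIMD mechanism) $$u(t_{k+1})=\begin{cases}A_1u(t_k)+B_1 & \text{if }\beta^{\top}u(t_k)\geq(2-\phi)\lambda,\\ A_2u(t_k)+B_2 & \text{if }\beta^{\top}u(t_k)<(2-\phi)\lambda,\end{cases}\qquad k\in\mathbb{N},$$ with initial state $u(t_0)\in\mathbb{R}^n$ having nonnegative components, where $$A_1=\mathrm{diag}\{\beta\}-\frac{2\alpha\beta^{\top}}{\sum_{i=1}^{n}\alpha_i},\quad A_2=\mathrm{diag}\{\beta\}-\frac{\alpha\beta^{\top}}{\sum_{i=1}^{n}\alpha_i},\quad B_1=\frac{2\lambda\alpha}{\sum_{i=1}^{n}\alpha_i},\quad B_2=\frac{\phi\lambda\alpha}{\sum_{i=1}^{n}\alpha_i}.$$ Then the following hold. 1. The system converges to a fixed point $u_{\mathrm{con}}=(u_1^{\mathrm{con}},\ldots,u_n^{\mathrm{con}})\in\mathbb{R}^n$, i.e. $\lim_{k\to\infty}u(t_k)=u_{\mathrm{con}}$, with $$u_i^{\mathrm{con}}=(1-\beta_i)^{-1}\alpha_i\mathsf{T}^{\ast},\qquad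 \mathsf{T}^{\ast}=\frac{2\lambda}{\sum_{i=1}^{n}\frac{1+\beta_i}{1-\beta_i}\alpha_i}.$$ 2. The dispatcher's backlog $\delta$, defined in the context as the solution of $\dot\delta(t)=\lambda-\sum_{i=1}^{n}u_i(t)$, is bounded.
   Context: $\mathrm{diag}\{\beta\}$ is the diagonal matrix with diagonal entries $\beta_1,\ldots,\beta_n$, and $\mathbb{N}=\{0,1,\ldots\}$. The switched system describes event-triggered scheduling rates $u_i(t)$. The event times $t_0<t_1<t_2<\cdots$ satisfy $t_{k+1}=t_k+\mathsf{T}_k$ with $$\mathsf{T}_k=\begin{cases}\dfrac{2\left(\lambda-\beta^{\top}u(t_k)\right)}{\sum_{i=1}^{n}\alpha_i} & \text{if }\beta^{\top}u(t_k)\geq(2-\phi)\lambda,\\[2mm] \dfrac{\phi\lambda-\beta^{\top}u(t_k)}{\sum_{i=1}^{n}\alpha_i} & \text{if }\beta^{\top}u(t_k)<(2-\phi)\lambda,\end{cases}$$ and between events the rates evolve as $$u_i(t)=\beta_iu_i(t_k)+\alpha_i(t-t_k),\qquad t\in(t_k,t_{k+1}],$$ which, evaluated at $t=t_{k+1}$, gives the switched system in the claim. For the statement about the backlog, it is a standing assumption that the event times are well defined, i.e. $\mathsf{T}_k>0$ (so $t_{k+1}>t_k$) for all $k\in\mathbb{N}$. The dispatcher's backlog is the continuous function $\delta(t)$, $t\geq t_0$, with given finite initial value $\delta(t_0)\geq0$ and $$\dot\delta(t)=\lambda-\sum_{i=1}^{n}u_i(t)$$ on each interval $(t_k,t_{k+1})$.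 Here $\lambda$ is the constant arrival rate of requests. *)

theory Defs
  imports "HOL-Analysis.Analysis"
begin

definition diag_mat :: "real^'n \<Rightarrow> real^'n^'n" where
  "diag_mat b = (\<chi> i j. if i = j then b $ i else 0)"

definition outer_prod :: "real^'n \<Rightarrow> real^'n \<Rightarrow> real^'n^'n" where
  "outer_prod a b = (\<chi> i j. a $ i * b $ j)"

definition aimd_A1 :: "real^'n \<Rightarrow> real^'n \<Rightarrow> real^'n^'n" where
  "aimd_A1 \<alpha> \<beta> = diag_mat \<beta> - (2 / (\<Sum>i\<in>UNIV. \<alpha> $ i)) *\<^sub>R outer_prod \<alpha> \<beta>"

definition aimd_A2 :: "real^'n \<Rightarrow> real^'n \<Rightarrow> real^'n^'n" where
  "aimd_A2 \<alpha> \<beta> = diag_mat \<beta> - (1 / (\<Sum>i\<in>UNIV. \<alpha> $ i)) *\<^sub>R outer_prod \<alpha> \<beta>"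

definition aimd_B1 :: "real \<Rightarrow> real^'n \<Rightarrow> real^'n" where
  "aimd_B1 lam \<alpha> = (2 * lam / (\<Sum>i\<in>UNIV. \<alpha> $ i)) *\<^sub>R \<alpha>"

definition aimd_B2 :: "real \<Rightarrow> real \<Rightarrow> real^'n \<Rightarrow> real^'n" where
  "aimd_B2 lam \<phi> \<alpha> = (\<phi> * lam / (\<Sum>i\<in>UNIV. \<alpha> $ i)) *\<^sub>R \<alpha>"

definition aimd_step :: "real \<Rightarrow> real \<Rightarrow> real^'n \<Rightarrow> real^'n \<Rightarrow> real^'n \<Rightarrow> real^'n" where
  "aimd_step lam \<phi> \<alpha> \<beta> x =
     (if \<beta> \<bullet> x \<ge> (2 - \<phi>) * lam
      then aimd_A1 \<alpha> \<beta> *v x + aimd_B1 lam \<alpha>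
      else aimd_A2 \<alpha> \<beta> *v x + aimd_B2 lam \<phi> \<alpha>)"

definition aimd_T_star :: "real \<Rightarrow> real^'n \<Rightarrow> real^'n \<Rightarrow> real" where
  "aimd_T_star lam \<alpha> \<beta> = 2 * lam / (\<Sum>i\<in>UNIV. (1 + \<beta> $ i) / (1 - \<beta> $ i) * \<alpha> $ i)"

definition aimd_u_con :: "real \<Rightarrow> real^'n \<Rightarrow> real^'n \<Rightarrow> real^'n" where
  "aimd_u_con lam \<alpha> \<beta> = (\<chi> i. inverse (1 - \<beta> $ i) * \<alpha> $ i * aimd_T_star lam \<alpha> \<beta>)"

text \<open>Time to the next event, as a function of the rates at the current event.\<close>

definition aimd_period :: "real \<Rightarrow> real \<Rightarrow> real^'n \<Rightarrow> real^'n \<Rightarrow> real^'n \<Rightarrow> real" where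
  "aimd_period lam \<phi> \<alpha> \<beta> x =
     (if \<beta> \<bullet> x \<ge> (2 - \<phi>) * lam
      then 2 * (lam - \<beta> \<bullet> x) / (\<Sum>i\<in>UNIV. \<alpha> $ i)
      else (\<phi> * lam - \<beta> \<bullet> x) / (\<Sum>i\<in>UNIV. \<alpha> $ i))"

text \<open>
  Here \<open>t k\<close> is the \<open>k\<close>-th event time and \<open>r s\<close> the vector of rates at time \<open>s\<close>. Positivity of the
  periods is the standing assumption that the event times are well defined; it is not automatic,
  even for nonnegative initial rates.
\<close>

definition aimd_rates ::
  "real \<Rightarrow> real \<Rightarrow> real^'n \<Rightarrow> real^'n \<Rightarrow> (nat \<Rightarrow> real) \<Rightarrow> (real \<Rightarrow> real^'n) \<Rightarrow> bool" where
  "aimd_rates lam \<phi> \<alpha> \<beta> t r \<longleftrightarrow>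
     (\<forall>k. t (Suc k) = t k + aimd_period lam \<phi> \<alpha> \<beta> (r (t k))) \<and>
     (\<forall>k. aimd_period lam \<phi> \<alpha> \<beta> (r (t k)) > 0) \<and>
     (\<forall>k. \<forall>s \<in> {t k<..t (Suc k)}. \<forall>i. r s $ i = \<beta> $ i * r (t k) $ i + \<alpha> $ i * (s - t k))"

text \<open>
  The backlog is only constrained on \<open>{t 0..}\<close>; it need not be differentiable at event times.
\<close>

definition is_backlog ::
  "real \<Rightarrow> (nat \<Rightarrow> real) \<Rightarrow> (real \<Rightarrow> real^'n) \<Rightarrow> (real \<Rightarrow> real) \<Rightarrow> bool" where
  "is_backlog lam t r \<delta> \<longleftrightarrow>
     continuous_on {t 0..} \<delta> \<and> \<delta> (t 0) \<ge> 0 \<and>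
     (\<forall>k. \<forall>s \<in> {t k<..<t (Suc k)}.
        (\<delta> has_real_derivative (lam - (\<Sum>i\<in>UNIV. r s $ i))) (at s))"

end

theory Submission
  imports Defs
begin

text \<open>
  The constraint relating \<open>\<phi>\<close> to \<open>\<alpha>\<close> and \<open>\<beta>\<close> makes both modes share the fixed point
  \<open>u_con\<close>, which lies exactly on the switching surface \<open>\<beta> \<bullet> x = (2 - \<phi>) lam\<close>. For the deviation
  \<open>e = x - u_con\<close> the system is therefore homogeneous, \<open>e'\<^sub>i = \<beta>\<^sub>i e\<^sub>i - g \<alpha>\<^sub>i / S\<close> with
  \<open>S = \<Sum>\<alpha>\<^sub>i\<close> and \<open>g = 2 (\<beta> \<bullet> e)\<close> or \<open>g = \<beta> \<bullet> e\<close>. Since \<open>g\<^sup>2 \<le> 2 g (\<beta> \<bullet> e)\<close>, the quadratic form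
  \<open>V e = \<Sum>e\<^sub>i\<^sup>2 / \<alpha>\<^sub>i\<close> satisfies \<open>V e' \<le> \<Sum>\<beta>\<^sub>i\<^sup>2 e\<^sub>i\<^sup>2 / \<alpha>\<^sub>i\<close>, so it is a common Lyapunov function for
  both modes and the convergence is geometric. The backlog does not change over a period in the
  first mode, and changes by a multiple of \<open>\<beta> \<bullet> e\<close> in the second; these changes are summable.
\<close>

locale aimd =
  fixes lam \<phi> :: real and \<alpha> \<beta> :: "real^'n"
  assumes lam_pos: "lam > 0"
    and phi_gt_1: "1 < \<phi>"
    and alpha_pos: "\<And>i. \<alpha> $ i > 0"
    and beta_pos: "\<And>i. 0 < \<beta> $ i"
    and beta_less_1: "\<And>i. \<beta> $ i < 1"
    and phi_eq: "1 + (\<Sum>i\<in>UNIV. \<alpha> $ i) / (\<Sum>i\<in>UNIV. (1 + \<beta> $ i) / (1 - \<beta> $ i) * \<alpha> $ i) = \<phi>"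
begin

abbreviation "S \<equiv> \<Sum>i\<in>UNIV. \<alpha> $ i"
abbreviation "T_star \<equiv> aimd_T_star lam \<alpha> \<beta>"
abbreviation "u_con \<equiv> aimd_u_con lam \<alpha> \<beta>"
abbreviation "step \<equiv> aimd_step lam \<phi> \<alpha> \<beta>"
abbreviation "period \<equiv> aimd_period lam \<phi> \<alpha> \<beta>"

definition lyapunov :: "real^'n \<Rightarrow> real" where
  "lyapunov e = (\<Sum>i\<in>UNIV. (e $ i)\<^sup>2 / \<alpha> $ i)"

definition rate :: real where
  "rate = Max (range (($) \<beta>))"

section \<open>Signs of the constants and the componentwise dynamics\<close>

lemma S_pos: "S > 0"
  by (intro sum_pos) (auto simp: alpha_pos)

lemma beta_le_rate: "\<beta> $ i \<le> rate"
  unfolding rate_def by (intro Max_ge) auto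

lemma rate_pos: "0 < rate"
  using beta_pos beta_le_rate less_le_trans by blast

lemma rate_less_1: "rate < 1"
  unfolding rate_def by (subst Max_less_iff) (auto simp: beta_less_1)

lemma rate_power_tendsto_0: "(\<lambda>k. C * rate ^ k) \<longlonglongrightarrow> 0"
  using rate_pos rate_less_1 by (intro tendsto_mult_right_zero LIMSEQ_realpow_zero) auto

text \<open>In either mode the rank-one part of the matrix and the constant vector combine to
  \<open>period x\<close> times \<open>\<alpha>\<close>, so the switching is confined to the scalar
  \<open>period x\<close>.\<close>

lemma step_component: "step x $ i = \<beta> $ i * x $ i + \<alpha> $ i * period x"
proof -
  have diag: "(diag_mat \<beta> *v x) $ i = \<beta> $ i * x $ i"
    by (simp add: diag_mat_def matrix_vector_mult_def if_distrib [of "\<lambda>z. z * _"] cong: if_cong)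
  have outer: "(outer_prod \<alpha> \<beta> *v x) $ i = \<alpha> $ i * (\<beta> \<bullet> x)"
    by (simp add: outer_prod_def matrix_vector_mult_def inner_vec_def sum_distrib_left mult.assoc)
  show ?thesis
    using S_pos
    by (simp add: aimd_step_def aimd_period_def aimd_A1_def aimd_A2_def aimd_B1_def aimd_B2_def
        matrix_vector_mult_diff_rdistrib scaleR_matrix_vector_assoc [symmetric] diag outer
        field_simps)
qed

section \<open>The common fixed point\<close>

lemma S_T_star: "S * T_star = 2 * (\<phi> - 1) * lam"
  and T_star_pos: "T_star > 0"
proof -
  \<comment> \<open>The constraint \<open>phi_eq\<close> enters here: the ratio of \<open>S\<close>
    to the denominator of \<open>T_star\<close> is \<open>\<phi> - 1\<close>.\<close>
  show "S * T_star = 2 * (\<phi> - 1) * lam"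
    unfolding aimd_T_star_def phi_eq [symmetric] by simp
  then have "S * T_star > 0"
    using phi_gt_1 lam_pos by simp
  then show "T_star > 0"
    using S_pos zero_less_mult_pos by blast
qed

lemma u_con_component: "u_con $ i = \<beta> $ i * u_con $ i + \<alpha> $ i * T_star"
  using beta_less_1 [of i] by (simp add: aimd_u_con_def field_simps)

text \<open>Since b / (1 - b) = ((1 + b) / (1 - b) - 1) / 2, the product reduces to the two sums
  that define \<open>T_star\<close> and \<open>S\<close>.\<close>

lemma beta_u_con: "\<beta> \<bullet> u_con = (2 - \<phi>) * lam"
proof -
  define P where "P = (\<Sum>i\<in>UNIV. (1 + \<beta> $ i) / (1 - \<beta> $ i) * \<alpha> $ i)"
  have P_pos: "P > 0"
    unfolding P_def
    by (intro sum_pos mult_pos_pos divide_pos_pos)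
       (auto simp: alpha_pos beta_less_1 intro: add_pos_pos beta_pos)
  have "\<beta> $ i * u_con $ i = ((1 + \<beta> $ i) / (1 - \<beta> $ i) * \<alpha> $ i - \<alpha> $ i) * (T_star / 2)" for i
    using beta_less_1 [of i] by (simp add: aimd_u_con_def field_simps)
  then have "\<beta> \<bullet> u_con = (P - S) * (T_star / 2)"
    by (simp add: inner_vec_def P_def sum_distrib_right [symmetric] sum_subtractf
        del: times_divide_eq_right)
  also have "\<dots> = (P * T_star - S * T_star) / 2"
    by (simp add: left_diff_distrib)
  also have "P * T_star = 2 * lam"
    using P_pos unfolding aimd_T_star_def P_def [symmetric] by simp
  also have "(2 * lam - S * T_star) / 2 = (2 - \<phi>) * lam"
    unfolding S_T_star by (simp add: field_simps)
  finally show ?thesis .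
qed

text \<open>Both period formulas give \<open>T_star\<close> at \<open>u_con\<close>, so the
  constants cancel and only a linear term in the deviation is left. The factor \<open>g\<close>
  stands for either mode, which saves later case distinctions.\<close>

lemma period_deviation:
  obtains g where "g = \<beta> \<bullet> (x - u_con) \<or> g = 2 * (\<beta> \<bullet> (x - u_con))"
    and "period x = T_star - g / S"
proof (cases "\<beta> \<bullet> x \<ge> (2 - \<phi>) * lam")
  case True
  with S_pos S_T_star have "period x = T_star - 2 * (\<beta> \<bullet> (x - u_con)) / S"
    by (simp add: aimd_period_def inner_diff_right beta_u_con field_simps)
  with that show ?thesis by blast
next
  case False
  with S_pos S_T_star have "period x = T_star - (\<beta> \<bullet> (x - u_con)) / S"
    by (simp add: aimd_period_def inner_diff_right beta_u_con field_simps)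
  with that show ?thesis by blast
qed

lemma abs_period_deviation: "\<bar>period x - T_star\<bar> \<le> 2 * \<bar>\<beta> \<bullet> (x - u_con)\<bar> / S"
proof -
  obtain g where "g = \<beta> \<bullet> (x - u_con) \<or> g = 2 * (\<beta> \<bullet> (x - u_con))"
    and "period x = T_star - g / S"
    by (rule period_deviation)
  then show ?thesis
    using S_pos by (auto simp: abs_mult intro!: divide_right_mono)
qed

lemma step_u_con: "step u_con = u_con"
proof -
  have "period u_con = T_star"
    using abs_period_deviation [of u_con] by simp
  then show ?thesis
    by (simp add: vec_eq_iff step_component u_con_component [symmetric])
qed

section \<open>Contraction in a weighted Euclidean norm\<close>

lemma lyapunov_step: "lyapunov (step x - u_con) \<le> rate\<^sup>2 * lyapunov (x - u_con)"
proof -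
  define e where "e = x - u_con"
  obtain g where g: "g = \<beta> \<bullet> e \<or> g = 2 * (\<beta> \<bullet> e)" and period: "period x = T_star - g / S"
    unfolding e_def by (rule period_deviation)
  \<comment> \<open>The weight 1 / \<open>\<alpha> $ i\<close> is chosen so that, after summation,
    the cross term becomes a multiple of \<open>\<beta> \<bullet> e\<close> and the last term a
    multiple of \<open>S\<close>.\<close>
  have summand: "((step x - u_con) $ i)\<^sup>2 / \<alpha> $ i
      = (\<beta> $ i)\<^sup>2 * ((e $ i)\<^sup>2 / \<alpha> $ i) - 2 * g / S * (\<beta> $ i * e $ i) + (g / S)\<^sup>2 * \<alpha> $ i" for i
  proof -
    have "(step x - u_con) $ i = \<beta> $ i * e $ i - \<alpha> $ i * (g / S)"
      using u_con_component [of i] by (simp add: step_component period e_def algebra_simps)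
    then have "((step x - u_con) $ i)\<^sup>2 / \<alpha> $ i = (\<beta> $ i * e $ i - \<alpha> $ i * (g / S))\<^sup>2 / \<alpha> $ i"
      by simp
    also have "\<dots> = (\<beta> $ i)\<^sup>2 * ((e $ i)\<^sup>2 / \<alpha> $ i) - 2 * (g / S) * (\<beta> $ i * e $ i)
        + (g / S)\<^sup>2 * \<alpha> $ i"
      using alpha_pos [of i] by (simp add: field_simps power2_eq_square del: times_divide_eq_left)
    finally show ?thesis by simp
  qed
  have "lyapunov (step x - u_con)
      = (\<Sum>i\<in>UNIV. (\<beta> $ i)\<^sup>2 * ((e $ i)\<^sup>2 / \<alpha> $ i)) - 2 * g / S * (\<beta> \<bullet> e) + (g / S)\<^sup>2 * S"
    unfolding lyapunov_def summand
    by (simp only: sum.distrib sum_subtractf sum_distrib_left [symmetric] inner_vec_def inner_real_def)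
  also have "\<dots> = (\<Sum>i\<in>UNIV. (\<beta> $ i)\<^sup>2 * ((e $ i)\<^sup>2 / \<alpha> $ i)) + (g\<^sup>2 - 2 * g * (\<beta> \<bullet> e)) / S"
    using S_pos by (simp add: field_simps power2_eq_square)
  \<comment> \<open>The numerator dropped here is 0 for the doubled \<open>g\<close> and minus the
    square of \<open>\<beta> \<bullet> e\<close> for the other.\<close>
  also have "\<dots> \<le> (\<Sum>i\<in>UNIV. (\<beta> $ i)\<^sup>2 * ((e $ i)\<^sup>2 / \<alpha> $ i))"
    using g S_pos by (auto simp: power2_eq_square divide_le_0_iff)
  also have "\<dots> \<le> (\<Sum>i\<in>UNIV. rate\<^sup>2 * ((e $ i)\<^sup>2 / \<alpha> $ i))"
    using alpha_pos beta_pos beta_le_rate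
    by (intro sum_mono mult_right_mono power_mono) (auto simp: less_imp_le)
  also have "\<dots> = rate\<^sup>2 * lyapunov e"
    by (simp add: lyapunov_def sum_distrib_left)
  finally show ?thesis
    by (simp add: e_def)
qed

lemma abs_component_le: "\<bar>e $ i\<bar> \<le> sqrt (\<alpha> $ i * lyapunov e)"
proof (rule real_le_rsqrt)
  have "(e $ i)\<^sup>2 / \<alpha> $ i \<le> lyapunov e"
    unfolding lyapunov_def using alpha_pos
    by (intro member_le_sum) (auto simp: less_imp_le)
  then show "\<bar>e $ i\<bar>\<^sup>2 \<le> \<alpha> $ i * lyapunov e"
    using alpha_pos [of i] by (simp add: field_simps)
qed

section \<open>Geometric convergence of orbits\<close>

context
  fixes u :: "nat \<Rightarrow> real^'n"
  assumes u_Suc: "\<And>k. u (Suc k) = step (u k)"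
begin

lemma lyapunov_orbit: "lyapunov (u k - u_con) \<le> (rate ^ k)\<^sup>2 * lyapunov (u 0 - u_con)"
proof (induction k)
  case (Suc k)
  have "lyapunov (u (Suc k) - u_con) \<le> rate\<^sup>2 * lyapunov (u k - u_con)"
    unfolding u_Suc by (rule lyapunov_step)
  also have "\<dots> \<le> rate\<^sup>2 * ((rate ^ k)\<^sup>2 * lyapunov (u 0 - u_con))"
    by (intro mult_left_mono Suc.IH) simp
  finally show ?case
    by (simp add: power_mult_distrib mult.assoc)
qed simp

lemma orbit_component_deviation:
  "\<bar>(u k - u_con) $ i\<bar> \<le> sqrt (\<alpha> $ i * lyapunov (u 0 - u_con)) * rate ^ k"
proof -
  have "\<bar>(u k - u_con) $ i\<bar> \<le> sqrt (\<alpha> $ i * lyapunov (u k - u_con))"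
    by (rule abs_component_le)
  also have "\<dots> \<le> sqrt (\<alpha> $ i * ((rate ^ k)\<^sup>2 * lyapunov (u 0 - u_con)))"
    using alpha_pos by (intro real_sqrt_le_mono mult_left_mono lyapunov_orbit) (simp add: less_imp_le)
  also have "\<dots> = sqrt (\<alpha> $ i * lyapunov (u 0 - u_con)) * rate ^ k"
    using rate_pos by (simp add: real_sqrt_mult)
  finally show ?thesis .
qed

lemma orbit_tendsto: "u \<longlonglongrightarrow> u_con"
proof (rule vec_tendstoI)
  fix i
  have "(\<lambda>k. u k $ i - u_con $ i) \<longlonglongrightarrow> 0"
    using orbit_component_deviation [of _ i]
    by (intro Lim_null_comparison [OF always_eventually rate_power_tendsto_0]) auto
  then show "(\<lambda>k. u k $ i) \<longlonglongrightarrow> u_con $ i"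
    by (simp add: LIM_zero_iff)
qed

text \<open>This scalar controls both the deviation of the periods from \<open>T_star\<close> and
  the change of the backlog over a period.\<close>

lemma beta_orbit_deviation:
  obtains C where "\<And>k. \<bar>\<beta> \<bullet> (u k - u_con)\<bar> \<le> C * rate ^ k"
proof
  fix k
  have "\<bar>\<beta> \<bullet> (u k - u_con)\<bar> \<le> (\<Sum>i\<in>UNIV. \<bar>\<beta> $ i * (u k - u_con) $ i\<bar>)"
    unfolding inner_vec_def inner_real_def by (rule sum_abs)
  also have "\<dots> \<le> (\<Sum>i\<in>UNIV. \<beta> $ i * (sqrt (\<alpha> $ i * lyapunov (u 0 - u_con)) * rate ^ k))"
    unfolding abs_mult using beta_pos
    by (intro sum_mono mult_mono orbit_component_deviation) (auto simp: less_imp_le abs_of_pos)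
  also have "\<dots> = (\<Sum>i\<in>UNIV. \<beta> $ i * sqrt (\<alpha> $ i * lyapunov (u 0 - u_con))) * rate ^ k"
    by (simp add: sum_distrib_right mult.assoc)
  finally show "\<bar>\<beta> \<bullet> (u k - u_con)\<bar>
      \<le> (\<Sum>i\<in>UNIV. \<beta> $ i * sqrt (\<alpha> $ i * lyapunov (u 0 - u_con))) * rate ^ k" .
qed

end

section \<open>The backlog\<close>

lemma rates_orbit:
  assumes "aimd_rates lam \<phi> \<alpha> \<beta> t r"
  shows "r (t (Suc k)) = step (r (t k))"
proof -
  \<comment> \<open>The half-open interval contains its right end because periods are positive, so
    the formula for the rates holds at the next event.\<close>
  have "t (Suc k) - t k = period (r (t k))" "t (Suc k) \<in> {t k<..t (Suc k)}"
    using assms by (auto simp: aimd_rates_def)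
  moreover from this have "r (t (Suc k)) $ i = \<beta> $ i * r (t k) $ i + \<alpha> $ i * (t (Suc k) - t k)" for i
    using assms unfolding aimd_rates_def by blast
  ultimately show ?thesis
    by (simp add: vec_eq_iff step_component)
qed

text \<open>The total rate is affine in time between events, so the backlog is a quadratic there;
  continuity extends this to both event times.\<close>

lemma backlog_within_period:
  assumes rates: "aimd_rates lam \<phi> \<alpha> \<beta> t r" and backlog: "is_backlog lam t r \<delta>"
    and s: "s \<in> {t k..t (Suc k)}"
  shows "\<delta> s = \<delta> (t k) + (lam - \<beta> \<bullet> r (t k)) * (s - t k) - S * (s - t k)\<^sup>2 / 2"
proof -
  define p where "p s = (lam - \<beta> \<bullet> r (t k)) * (s - t k) - S * (s - t k)\<^sup>2 / 2" for s
  have t_less: "t k < t (Suc k)" for k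
    using rates unfolding aimd_rates_def by (metis less_add_same_cancel1)
  then have "t 0 \<le> t k"
    by (rule lift_Suc_mono_le [of t, OF less_imp_le]) simp
  have cont: "continuous_on {t k..t (Suc k)} (\<lambda>s. \<delta> s - p s)"
    using backlog \<open>t 0 \<le> t k\<close> unfolding p_def is_backlog_def
    by (intro continuous_intros) (auto elim: continuous_on_subset)
  have deriv: "((\<lambda>s. \<delta> s - p s) has_real_derivative 0) (at x)" if x: "t k < x" "x < t (Suc k)" for x
  proof -
    have "r x $ i = \<beta> $ i * r (t k) $ i + \<alpha> $ i * (x - t k)" for i
      using rates x by (simp add: aimd_rates_def)
    then have "(\<Sum>i\<in>UNIV. r x $ i) = \<beta> \<bullet> r (t k) + S * (x - t k)"
      by (simp add: inner_vec_def sum.distrib sum_distrib_right)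
    moreover have "(\<delta> has_real_derivative (lam - (\<Sum>i\<in>UNIV. r x $ i))) (at x)"
      using backlog x by (simp add: is_backlog_def)
    ultimately show ?thesis
      unfolding p_def by (auto intro!: derivative_eq_intros)
  qed
  have "\<delta> s - p s = \<delta> (t k) - p (t k)"
    using s by (intro DERIV_isconst2 [OF t_less cont deriv]) auto
  then show ?thesis
    by (simp add: p_def)
qed

text \<open>In the first mode the period is the nonzero root of the quadratic that describes the
  increment, which therefore vanishes. In the second mode half of the deviation remains as a
  factor.\<close>

lemma backlog_increment:
  assumes "aimd_rates lam \<phi> \<alpha> \<beta> t r" and "is_backlog lam t r \<delta>"
  shows "\<bar>\<delta> (t (Suc k)) - \<delta> (t k)\<bar> \<le> period (r (t k)) * \<bar>\<beta> \<bullet> (r (t k) - u_con)\<bar>"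
proof -
  define T where "T = period (r (t k))"
  have T: "t (Suc k) = t k + T" "T > 0"
    using assms by (auto simp: aimd_rates_def T_def)
  have "\<delta> (t (Suc k)) - \<delta> (t k) = T * ((lam - \<beta> \<bullet> r (t k)) - S * T / 2)"
    using backlog_within_period [OF assms, of "t (Suc k)" k] T
    by (simp add: algebra_simps power2_eq_square)
  moreover have "\<bar>(lam - \<beta> \<bullet> r (t k)) - S * T / 2\<bar> \<le> \<bar>\<beta> \<bullet> (r (t k) - u_con)\<bar>"
  proof (cases "\<beta> \<bullet> r (t k) \<ge> (2 - \<phi>) * lam")
    case True
    then show ?thesis
      using S_pos by (simp add: T_def aimd_period_def field_simps)
  next
    case False
    then have "(lam - \<beta> \<bullet> r (t k)) - S * T / 2 = - (\<beta> \<bullet> (r (t k) - u_con)) / 2"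
      using S_pos by (simp add: T_def aimd_period_def inner_diff_right beta_u_con field_simps)
    then show ?thesis by simp
  qed
  ultimately show ?thesis
    using T by (simp add: T_def abs_mult mult_left_mono)
qed

lemma bounded_backlog:
  assumes rates: "aimd_rates lam \<phi> \<alpha> \<beta> t r" and backlog: "is_backlog lam t r \<delta>"
  shows "bounded (\<delta> ` {t 0..})"
proof -
  define d where "d k = \<beta> \<bullet> (r (t k) - u_con)" for k
  define T where "T k = period (r (t k))" for k
  obtain C where d_le: "\<bar>d k\<bar> \<le> C * rate ^ k" for k
    using beta_orbit_deviation [of "\<lambda>k. r (t k)", OF rates_orbit [OF rates]]
    unfolding d_def by blast
  have C_nonneg: "C \<ge> 0"
    using d_le [of 0] by simp
  have d_le_C: "\<bar>d k\<bar> \<le> C" for k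
    using d_le [of k] mult_left_le [OF power_le_one C_nonneg, of rate k] rate_pos rate_less_1
    by (simp add: less_imp_le)
  have t_Suc: "t (Suc k) = t k + T k" and T_pos: "T k > 0" for k
    using rates by (auto simp: aimd_rates_def T_def)
  have t_mono: "incseq t"
    using t_Suc T_pos by (intro incseq_SucI) (simp add: less_imp_le)
  have T_dev: "\<bar>T k - T_star\<bar> \<le> 2 * \<bar>d k\<bar> / S" for k
    unfolding T_def d_def by (rule abs_period_deviation)
  define B where "B = T_star + 2 * C / S"
  have T_le: "T k \<le> B" for k
  proof -
    have "2 * \<bar>d k\<bar> / S \<le> 2 * C / S"
      using S_pos d_le_C by (intro divide_right_mono) auto
    with T_dev [of k] show ?thesis
      by (simp add: B_def abs_le_iff)
  qed
  have B_nonneg: "B \<ge> 0"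
    using T_le [of 0] T_pos [of 0] by simp
  \<comment> \<open>Events cannot accumulate: convergence of \<open>t\<close> would force the
    periods to 0, but they tend to \<open>T_star > 0\<close>. Hence the periods cover all of
    \<open>{t 0..}\<close>.\<close>
  have t_unbounded: "\<exists>k. s < t k" for s
  proof (rule ccontr)
    assume "\<not> ?thesis"
    then have "\<forall>k. t k \<le> s"
      by (simp add: not_less)
    then obtain L where L: "t \<longlonglongrightarrow> L"
      using incseq_convergent [OF t_mono] by blast
    have "(\<lambda>k. t (Suc k) - t k) \<longlonglongrightarrow> L - L"
      by (intro tendsto_diff LIMSEQ_Suc L)
    then have "T \<longlonglongrightarrow> 0"
      by (simp add: t_Suc)
    moreover have "(\<lambda>k. T k - T_star) \<longlonglongrightarrow> 0"
    proof (rule Lim_null_comparison [OF always_eventually rate_power_tendsto_0])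
      show "\<forall>k. norm (T k - T_star) \<le> 2 * C / S * rate ^ k"
      proof
        fix k
        have "2 * \<bar>d k\<bar> / S \<le> 2 * (C * rate ^ k) / S"
          using S_pos d_le by (intro divide_right_mono mult_left_mono) auto
        with T_dev [of k] show "norm (T k - T_star) \<le> 2 * C / S * rate ^ k"
          by simp
      qed
    qed
    ultimately show False
      using T_star_pos LIMSEQ_unique by (fastforce simp: LIM_zero_iff)
  qed
  \<comment> \<open>The increments are dominated by a geometric series with ratio
    \<open>rate\<close>.\<close>
  have at_events: "\<bar>\<delta> (t k)\<bar> \<le> \<bar>\<delta> (t 0)\<bar> + B * C / (1 - rate)" for k
  proof -
    have inc: "\<bar>\<delta> (t (Suc j)) - \<delta> (t j)\<bar> \<le> B * C * rate ^ j" for j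
    proof -
      have "\<bar>\<delta> (t (Suc j)) - \<delta> (t j)\<bar> \<le> T j * \<bar>d j\<bar>"
        unfolding T_def d_def by (rule backlog_increment [OF rates backlog])
      also have "\<dots> \<le> B * (C * rate ^ j)"
        using T_le d_le B_nonneg by (intro mult_mono) auto
      finally show ?thesis by (simp add: mult.assoc)
    qed
    have "\<delta> (t k) - \<delta> (t 0) = (\<Sum>j<k. \<delta> (t (Suc j)) - \<delta> (t j))"
      by (rule sum_lessThan_telescope [symmetric])
    also have "\<bar>\<dots>\<bar> \<le> (\<Sum>j<k. B * C * rate ^ j)"
      using inc by (intro order_trans [OF sum_abs] sum_mono)
    also have "\<dots> = B * C * (\<Sum>j<k. rate ^ j)"
      by (simp add: sum_distrib_left)
    also have "\<dots> \<le> B * C * (1 / (1 - rate))"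
    proof (intro mult_left_mono)
      have "(\<Sum>j<k. rate ^ j) = (1 - rate ^ k) / (1 - rate)"
        using rate_less_1 by (subst sum_gp_strict) simp
      also have "\<dots> \<le> 1 / (1 - rate)"
        using rate_pos rate_less_1 by (intro divide_right_mono) auto
      finally show "(\<Sum>j<k. rate ^ j) \<le> 1 / (1 - rate)" .
    qed (use B_nonneg C_nonneg in simp)
    finally show ?thesis by simp
  qed
  \<comment> \<open>The bound at events, plus bounds for the linear and the quadratic term within a
    period of length at most \<open>B\<close>.\<close>
  define D where "D = \<bar>\<delta> (t 0)\<bar> + B * C / (1 - rate) + ((\<phi> - 1) * lam + C) * B + S * B\<^sup>2 / 2"
  have "\<bar>\<delta> s\<bar> \<le> D" if s_ge: "s \<ge> t 0" for s
  proof -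
    obtain k where k: "s \<in> {t k..t (Suc k)}"
    proof -
      \<comment> \<open>The first event after \<open>s\<close> is not event 0, so it ends a period,
        and that period contains \<open>s\<close>.\<close>
      define m where "m = (LEAST k. s < t k)"
      have m: "s < t m"
        unfolding m_def using t_unbounded by (rule LeastI_ex)
      then have "m \<noteq> 0"
        using s_ge by (metis not_less)
      then obtain k where "m = Suc k"
        using not0_implies_Suc by blast
      moreover from this have "\<not> s < t k"
        unfolding m_def by (intro not_less_Least) simp
      ultimately show thesis
        using m by (intro that [of k]) auto
    qed
    define h where "h = s - t k"
    have h: "0 \<le> h" "h \<le> B"
      using k t_Suc [of k] T_le [of k] by (auto simp: h_def)
    have "\<bar>lam - \<beta> \<bullet> r (t k)\<bar> = \<bar>(\<phi> - 1) * lam - d k\<bar>"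
      by (simp add: d_def inner_diff_right beta_u_con algebra_simps)
    also have "\<dots> \<le> \<bar>(\<phi> - 1) * lam\<bar> + \<bar>d k\<bar>"
      by (rule abs_triangle_ineq4)
    also have "\<dots> \<le> (\<phi> - 1) * lam + C"
      using d_le_C [of k] phi_gt_1 lam_pos by simp
    finally have "\<bar>(lam - \<beta> \<bullet> r (t k)) * h\<bar> \<le> ((\<phi> - 1) * lam + C) * B"
      unfolding abs_mult using h by (intro mult_mono) auto
    moreover have "\<bar>S * h\<^sup>2 / 2\<bar> \<le> S * B\<^sup>2 / 2"
      using h S_pos by (simp add: abs_mult power_mono)
    moreover have "\<delta> s = \<delta> (t k) + (lam - \<beta> \<bullet> r (t k)) * h - S * h\<^sup>2 / 2"
      unfolding h_def by (rule backlog_within_period [OF rates backlog k])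
    ultimately show ?thesis
      using at_events [of k] unfolding D_def by linarith
  qed
  then show ?thesis
    by (auto simp: bounded_real)
qed

end

theorem theorem2:
  fixes lam \<phi> :: real and \<alpha> \<beta> :: "real^'n" and u :: "nat \<Rightarrow> real^'n"
  assumes "lam > 0" and "1 < \<phi>" and "\<phi> < 2"
    and "\<And>i. \<alpha> $ i > 0" and "\<And>i. 0 < \<beta> $ i" and "\<And>i. \<beta> $ i < 1"
    and "1 + (\<Sum>i\<in>UNIV. \<alpha> $ i) / (\<Sum>i\<in>UNIV. (1 + \<beta> $ i) / (1 - \<beta> $ i) * \<alpha> $ i) = \<phi>"
    and "\<And>i. u 0 $ i \<ge> 0"
    and "\<And>k. u (Suc k) = aimd_step lam \<phi> \<alpha> \<beta> (u k)"
  shows "aimd_step lam \<phi> \<alpha> \<beta> (aimd_u_con lam \<alpha> \<beta>) = aimd_u_con lam \<alpha> \<beta> \<and>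
         u \<longlonglongrightarrow> aimd_u_con lam \<alpha> \<beta> \<and>
         (\<forall>t r \<delta>. r (t 0) = u 0 \<longrightarrow> aimd_rates lam \<phi> \<alpha> \<beta> t r \<longrightarrow> is_backlog lam t r \<delta> \<longrightarrow>
            bounded (\<delta> ` {t 0..}))"
proof -
  interpret aimd lam \<phi> \<alpha> \<beta>
    using assms by unfold_locales
  show ?thesis
    using step_u_con orbit_tendsto [of u, OF assms(9)] bounded_backlog by blast
qed

end
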